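(* Let $0 < \phi < 1/2$ and let $X_1, X_2, \ldots$ be independent and identically distributed random variables with the $\text{Cantor}(\phi)$ distribution on $[0,1]$. For each $n$, let $V_n = \{X_1, \ldots, X_n\}$ and let $R_n = \inf\{ r > 0 : \mathcal{G}(V_n, r) \text{ is connected}\}$ be the connectivity threshold of the random geometric graph on $V_n$. Then, as $n \to \infty$, $$R_n \longrightarrow 1 - 2\phi \quad \text{almost surely.}$$
   Context: For $0<\phi<1/2$, the $\text{Cantor}(\phi)$ distribution is the law of the random variable $X = \sum_{i=1}^{\infty} \phi^{i-1} Z_i$, where the $Z_i$ are i.i.d. with $\mathbb{P}[Z_i = 0] = \mathbb{P}[Z_i = 1-\phi] = 1/2$. For a finite set $V \subset \mathbb{R}$ and $r > 0$, the geometric graph $\mathcal{G}(V, r)$ has vertex set $V$, and two distinct vertices $u, v \in V$ are adjacent if and only if $|u - v| \le r$. *)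

theory Defs
  imports "HOL-Probability.Probability" "Graph_Theory.Graph_Theory"
begin

text \<open>
  The infinite product measure below makes the coordinates of \<open>z\<close> i.i.d. and uniform on
  \<open>{0, 1 - \<phi>}\<close>. Coordinates are counted from 0, so \<open>z i\<close> is \<open>Z\<^bsub>i+1\<^esub>\<close> and has
  weight \<open>\<phi> ^ i\<close>.
\<close>

definition cantor_distribution :: "real \<Rightarrow> real measure" where
  "cantor_distribution \<phi> =
     distr (\<Pi>\<^sub>M i\<in>(UNIV :: nat set). measure_pmf (pmf_of_set {0, 1 - \<phi>})) borel
       (\<lambda>z. \<Sum>i. \<phi> ^ i * z i)"

text \<open>Undirected graphs are symmetric digraphs here: each edge is a pair of opposite arcs.\<close>

definition geometric_graph :: "real set \<Rightarrow> real \<Rightarrow> real pair_pre_digraph" where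
  "geometric_graph V r =
     \<lparr> pverts = V, parcs = {(u, v). u \<in> V \<and> v \<in> V \<and> u \<noteq> v \<and> \<bar>u - v\<bar> \<le> r} \<rparr>"

text \<open>The name is qualified because topological connectedness is also called \<open>connected\<close>.\<close>

definition connectivity_threshold :: "real set \<Rightarrow> real" where
  "connectivity_threshold V =
     Inf {r. r > 0 \<and> Digraph_Component.connected (with_proj (geometric_graph V r))}"

lemma measurable_cantor_series [measurable]:
  "(\<lambda>z. \<Sum>i. \<phi> ^ i * z i) \<in>
     (\<Pi>\<^sub>M i\<in>(UNIV :: nat set). measure_pmf (pmf_of_set {0, 1 - \<phi>})) \<rightarrow>\<^sub>M (borel :: real measure)"
proof -
  let ?P = "measure_pmf (pmf_of_set {0, 1 - \<phi>})"
  have "(\<lambda>z. z i) \<in> (\<Pi>\<^sub>M i\<in>(UNIV :: nat set). ?P) \<rightarrow>\<^sub>M borel" for i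
    using measurable_compose[OF measurable_component_singleton[of i UNIV "\<lambda>_. ?P"], of id borel]
    by simp
  note [measurable] = this
  show ?thesis by measurable
qed

lemma sets_cantor_distribution [simp, measurable_cong]:
  "sets (cantor_distribution \<phi>) = sets borel"
  by (simp add: cantor_distribution_def)

lemma prob_space_cantor_distribution: "prob_space (cantor_distribution \<phi>)"
proof -
  interpret product_prob_space "\<lambda>_. measure_pmf (pmf_of_set {0, 1 - \<phi>})" "UNIV :: nat set"
    by unfold_locales
  show ?thesis
    unfolding cantor_distribution_def by (rule prob_space_distr) (rule measurable_cantor_series)
qed

lemma pair_graph_geometric_graph:
  assumes "finite V"
  shows "pair_graph (geometric_graph V r)"
proof -
  have "finite {(u, v). u \<in> V \<and> v \<in> V \<and> u \<noteq> v \<and> \<bar>u - v\<bar> \<le> r}"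
    by (rule finite_subset[of _ "V \<times> V"]) (use assms in auto)
  then show ?thesis
    using assms
    by unfold_locales
      (auto simp: geometric_graph_def symmetric_def sym_def abs_minus_commute)
qed

end

theory Submission
  imports Defs
begin

text \<open>
  The connectivity threshold of a finite set of reals is its largest gap, so the claim is that
  the largest gap of the sample tends to \<open>1 - 2 * \<phi>\<close>, the length of the middle interval removed
  in the first step of the Cantor construction.

  Almost surely no sample point lies in the middle interval, and both sides of it are eventually
  hit; from then on every connecting radius has to bridge it
  (\<open>gap_le_connecting_radius\<close>).

  For the upper bound, cut the Cantor set into its \<open>2 ^ k\<close> cylinders of level \<open>k\<close>, each contained
  in an interval of length \<open>\<phi> ^ k\<close>. By self-similarity, the left endpoints of
  neighbouring cylinders differ by at most \<open>1 - 2 * \<phi> + \<phi> ^ k\<close>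
  (\<open>ex_next_left_endpoint\<close>). A set that meets all cylinders of level \<open>k\<close> therefore has gaps of at
  most \<open>1 - 2 * \<phi> + 2 * \<phi> ^ k\<close>. Every cylinder has positive probability because it
  is determined by finitely many fair digits (\<open>measure_cylinder_pos\<close>), so an
  independent sample almost surely meets each of them eventually (\<open>indep_vars_AE_hit\<close>). It remains
  to let \<open>k\<close> tend to infinity.
\<close>

section \<open>Connectivity of geometric graphs on the line\<close>

lemma connected_geometric_graph_iff:
  "Digraph_Component.connected (with_proj (geometric_graph V r)) \<longleftrightarrow>
     V \<noteq> {} \<and> (\<forall>u\<in>V. \<forall>v\<in>V. (u, v) \<in> (parcs (geometric_graph V r))\<^sup>*)"
proof -
  have sym: "mk_symmetric (with_proj (geometric_graph V r)) = geometric_graph V r"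
    by (auto simp: mk_symmetric_def geometric_graph_def abs_minus_commute)
  have reach: "u \<rightarrow>\<^sup>*\<^bsub>with_proj (geometric_graph V r)\<^esub> v \<longleftrightarrow>
      (u, v) \<in> (parcs (geometric_graph V r))\<^sup>*" if "u \<in> V" "v \<in> V" for u v
  proof
    assume "(u, v) \<in> (parcs (geometric_graph V r))\<^sup>*"
    then show "u \<rightarrow>\<^sup>*\<^bsub>with_proj (geometric_graph V r)\<^esub> v"
      unfolding reachable_def using that
      by (auto intro!: rtrancl_consistent_rtrancl_on simp: geometric_graph_def)
  next
    assume "u \<rightarrow>\<^sup>*\<^bsub>with_proj (geometric_graph V r)\<^esub> v"
    then show "(u, v) \<in> (parcs (geometric_graph V r))\<^sup>*"
      unfolding reachable_def by (auto dest: rtrancl_on_rtranclI)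
  qed
  have "pverts (geometric_graph V r) = V"
    by (simp add: geometric_graph_def)
  then show ?thesis
    unfolding Digraph_Component.connected_def strongly_connected_def sym
    using reach by auto
qed

text \<open>
  From any vertex one can climb towards a larger vertex \<open>b\<close> in steps of length at most \<open>r\<close>; if the
  next step would overshoot, then \<open>b\<close> itself is within reach.
\<close>

lemma connected_geometric_graphI:
  assumes "finite V" "V \<noteq> {}"
    and step: "\<And>a b. a \<in> V \<Longrightarrow> b \<in> V \<Longrightarrow> a < b \<Longrightarrow> \<exists>v\<in>V. a < v \<and> v \<le> a + r"
  shows "Digraph_Component.connected (with_proj (geometric_graph V r))"
proof -
  let ?E = "parcs (geometric_graph V r)"
  have E: "(u, v) \<in> ?E \<longleftrightarrow> u \<in> V \<and> v \<in> V \<and> u \<noteq> v \<and> \<bar>u - v\<bar> \<le> r" for u v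
    by (simp add: geometric_graph_def)
  have up: "(a, b) \<in> ?E\<^sup>*" if "a \<in> V" "b \<in> V" "a \<le> b" for a b
    using that
  proof (induction "card {v \<in> V. a < v}" arbitrary: a rule: less_induct)
    case less
    show ?case
    proof (cases "a = b")
      case False
      then have "a < b" using less.prems by simp
      then obtain v where v: "v \<in> V" "a < v" "v \<le> a + r"
        using step less.prems by blast
      show ?thesis
      proof (cases "v \<le> b")
        case True
        have "card {w \<in> V. v < w} < card {w \<in> V. a < w}"
          by (rule psubset_card_mono) (use v \<open>finite V\<close> in auto)
        then have "(v, b) \<in> ?E\<^sup>*"
          using less.hyps v(1) less.prems(2) True by blast
        moreover have "(a, v) \<in> ?E"
          using v less.prems E by auto
        ultimately show ?thesis
          by (rule converse_rtrancl_into_rtrancl[rotated])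
      next
        case False
        then have "(a, b) \<in> ?E"
          using v less.prems \<open>a < b\<close> E by auto
        then show ?thesis by blast
      qed
    qed simp
  qed
  have "sym (?E\<^sup>*)"
    by (intro sym_rtrancl symI) (auto simp: E abs_minus_commute)
  then have "(a, b) \<in> ?E\<^sup>*" if "a \<in> V" "b \<in> V" for a b
    using up[of a b] up[of b a] that by (meson linear symD)
  then show ?thesis
    using \<open>V \<noteq> {}\<close> by (simp add: connected_geometric_graph_iff)
qed

lemma gap_le_connecting_radius:
  assumes "Digraph_Component.connected (with_proj (geometric_graph V r))"
    and gap: "\<And>v. v \<in> V \<Longrightarrow> v \<le> s \<or> t \<le> v" and "s < t"
    and "a \<in> V" "a \<le> s" "b \<in> V" "t \<le> b"
  shows "t - s \<le> r"
proof (rule ccontr)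
  assume "\<not> t - s \<le> r"
  have "(a, b) \<in> (parcs (geometric_graph V r))\<^sup>*"
    using assms by (auto simp: connected_geometric_graph_iff)
  \<comment> \<open>No edge is long enough to leave the part of \<open>V\<close> to the left of the gap.\<close>
  then have "b \<le> s"
  proof (induction rule: rtrancl_induct)
    case (step y z)
    then show ?case
      using gap[of z] \<open>\<not> t - s \<le> r\<close> by (auto simp: geometric_graph_def)
  qed (fact \<open>a \<le> s\<close>)
  then show False using \<open>s < t\<close> \<open>t \<le> b\<close> by simp
qed

lemma connectivity_threshold_bounds:
  assumes "finite V" "0 < r"
    and step: "\<And>a b. a \<in> V \<Longrightarrow> b \<in> V \<Longrightarrow> a < b \<Longrightarrow> \<exists>v\<in>V. a < v \<and> v \<le> a + r"
    and gap: "\<And>v. v \<in> V \<Longrightarrow> v \<le> s \<or> t \<le> v" and "s < t"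
    and ab: "a \<in> V" "a \<le> s" "b \<in> V" "t \<le> b"
  shows "connectivity_threshold V \<in> {t - s..r}"
proof -
  let ?R = "{r. r > 0 \<and> Digraph_Component.connected (with_proj (geometric_graph V r))}"
  have "r \<in> ?R"
    using connected_geometric_graphI[of V r] assms by auto
  moreover have "t - s \<le> r'" if "r' \<in> ?R" for r'
    using gap_le_connecting_radius[of V r' s t a b] that gap ab \<open>s < t\<close> by blast
  moreover have "bdd_below ?R"
    by (rule bdd_belowI[of _ 0]) auto
  ultimately show ?thesis
    unfolding connectivity_threshold_def
    by (auto intro: cInf_lower cInf_greatest)
qed

section \<open>Cylinders of the Cantor set\<close>

primrec cantor_left_endpoints :: "real \<Rightarrow> nat \<Rightarrow> real set" where
  "cantor_left_endpoints \<phi> 0 = {0}"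
| "cantor_left_endpoints \<phi> (Suc k) =
     (\<lambda>p. \<phi> * p) ` cantor_left_endpoints \<phi> k \<union> (\<lambda>p. 1 - \<phi> + \<phi> * p) ` cantor_left_endpoints \<phi> k"

lemma finite_cantor_left_endpoints: "finite (cantor_left_endpoints \<phi> k)"
  by (induction k) auto

lemma zero_in_cantor_left_endpoints: "0 \<in> cantor_left_endpoints \<phi> k"
  by (induction k) auto

lemma cantor_left_endpoint_digits:
  assumes "p \<in> cantor_left_endpoints \<phi> k"
  shows "\<exists>z. (\<forall>i. z i \<in> {0, 1 - \<phi>}) \<and> p = (\<Sum>i<k. \<phi> ^ i * z i)"
  using assms
proof (induction k arbitrary: p)
  case 0
  then show ?case by (auto intro: exI[of _ "\<lambda>_. 0"])
next
  case (Suc k)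
  then obtain d q where d: "d \<in> {0, 1 - \<phi>}" and q: "q \<in> cantor_left_endpoints \<phi> k"
    and p: "p = d + \<phi> * q"
    by (metis (no_types, lifting) Un_iff add_0 cantor_left_endpoints.simps(2) imageE insertI1 insertI2)
  from Suc.IH[OF q] obtain z where
    z: "\<forall>i. z i \<in> {0, 1 - \<phi>}" "q = (\<Sum>i<k. \<phi> ^ i * z i)" by blast
  have "p = (\<Sum>i<Suc k. \<phi> ^ i * (case_nat d z) i)"
    by (simp add: p z(2) sum.lessThan_Suc_shift sum_distrib_left mult.assoc del: sum.lessThan_Suc)
  moreover have "\<forall>i. case_nat d z i \<in> {0, 1 - \<phi>}"
    using d z(1) by (auto split: nat.split)
  ultimately show ?case by blast
qed

text \<open>
  By induction along the self-similarity: inside either half the gaps are those of the previous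
  level scaled by \<open>\<phi>\<close>, and the new gap runs from the last left endpoint
  \<open>\<phi> * (1 - \<phi> ^ k)\<close> of the left half to the first left endpoint \<open>1 - \<phi>\<close> of the right half.
\<close>

lemma ex_next_left_endpoint:
  assumes "0 < \<phi>" "\<phi> < 1 / 2" "0 \<le> x" "x < 1 - \<phi> ^ k"
  shows "\<exists>p\<in>cantor_left_endpoints \<phi> k. x < p \<and> p \<le> x + (1 - 2 * \<phi> + \<phi> ^ k)"
  using assms(3,4)
proof (induction k arbitrary: x)
  case (Suc k)
  have scale: "\<phi> * (1 - 2 * \<phi> + \<phi> ^ k) \<le> 1 - 2 * \<phi> + \<phi> ^ Suc k"
    using mult_right_mono[of \<phi> 1 "1 - 2 * \<phi>"] assms(1,2) by (simp add: algebra_simps)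
  consider "x < \<phi> * (1 - \<phi> ^ k)" | "\<phi> * (1 - \<phi> ^ k) \<le> x" "x < 1 - \<phi>" | "1 - \<phi> \<le> x"
    by linarith
  then show ?case
  proof cases
    case 1
    then have "x / \<phi> < 1 - \<phi> ^ k" "0 \<le> x / \<phi>"
      using assms(1) Suc.prems by (auto simp: field_simps)
    then obtain p where p: "p \<in> cantor_left_endpoints \<phi> k" "x / \<phi> < p"
        "p \<le> x / \<phi> + (1 - 2 * \<phi> + \<phi> ^ k)"
      using Suc.IH by blast
    have "\<phi> * p \<le> \<phi> * (x / \<phi> + (1 - 2 * \<phi> + \<phi> ^ k))"
      using p(3) assms(1) by (intro mult_left_mono) auto
    also have "\<dots> = x + \<phi> * (1 - 2 * \<phi> + \<phi> ^ k)"
      using assms(1) by (simp add: distrib_left)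
    finally have "\<phi> * p \<le> x + (1 - 2 * \<phi> + \<phi> ^ Suc k)"
      using scale by linarith
    moreover have "x < \<phi> * p"
      using p(2) assms(1) by (simp add: field_simps)
    ultimately show ?thesis
      using p(1) by (auto intro!: bexI[of _ "\<phi> * p"])
  next
    case 2
    then have "1 - \<phi> \<le> x + (1 - 2 * \<phi> + \<phi> ^ Suc k)"
      by (simp add: algebra_simps)
    then show ?thesis
      using 2 zero_in_cantor_left_endpoints[of \<phi> k]
      by (auto intro!: bexI[of _ "1 - \<phi>"] image_eqI[of _ _ 0])
  next
    case 3
    define y where "y = (x - (1 - \<phi>)) / \<phi>"
    have x: "x = 1 - \<phi> + \<phi> * y"
      using assms(1) by (simp add: y_def)
    have "\<phi> * y < \<phi> * (1 - \<phi> ^ k)"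
      using Suc.prems by (simp add: x algebra_simps)
    then have "y < 1 - \<phi> ^ k"
      using assms(1) by simp
    moreover have "0 \<le> y"
      using 3 assms(1) by (simp add: y_def)
    ultimately obtain p where p: "p \<in> cantor_left_endpoints \<phi> k" "y < p"
        "p \<le> y + (1 - 2 * \<phi> + \<phi> ^ k)"
      using Suc.IH by blast
    have "\<phi> * p \<le> \<phi> * y + \<phi> * (1 - 2 * \<phi> + \<phi> ^ k)"
      using mult_left_mono[OF p(3), of \<phi>] assms(1) by (simp add: distrib_left)
    then have "1 - \<phi> + \<phi> * p \<le> x + (1 - 2 * \<phi> + \<phi> ^ Suc k)"
      using scale x by linarith
    moreover have "x < 1 - \<phi> + \<phi> * p"
      using p(2) assms(1) x by simp
    ultimately show ?thesis
      using p(1) by (auto intro!: bexI[of _ "1 - \<phi> + \<phi> * p"])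
  qed
qed simp

text \<open>
  Some vertex close to the right of \<open>a\<close> is found in the cylinder of the next left endpoint, whose
  length \<open>\<phi> ^ Suc k\<close> is added to the bound. From the last left endpoint \<open>1 - \<phi> ^ Suc k\<close> on, every
  larger vertex is close enough. The level is a successor so that \<open>1 - \<phi>\<close> is a left endpoint
  and both halves are hit.
\<close>

lemma connectivity_threshold_if_hits_cylinders:
  assumes \<phi>: "0 < \<phi>" "\<phi> < 1 / 2" and "finite V"
    and V: "V \<subseteq> {0..\<phi>} \<union> {1 - \<phi>..1}"
    and hit: "\<And>p. p \<in> cantor_left_endpoints \<phi> (Suc k) \<Longrightarrow> V \<inter> {p..p + \<phi> ^ Suc k} \<noteq> {}"
  shows "connectivity_threshold V \<in> {1 - 2 * \<phi>..1 - 2 * \<phi> + 2 * \<phi> ^ Suc k}"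
proof -
  have pow: "0 < \<phi> ^ Suc k" "\<phi> ^ Suc k \<le> \<phi>"
    using \<phi> power_decreasing[of 1 "Suc k" \<phi>] by auto
  obtain u where u: "u \<in> V" "u \<le> \<phi>"
    using hit[OF zero_in_cantor_left_endpoints] pow(2) by fastforce
  have "1 - \<phi> \<in> cantor_left_endpoints \<phi> (Suc k)"
    using zero_in_cantor_left_endpoints[of \<phi> k] by (auto intro!: image_eqI[of _ _ 0])
  from hit[OF this] obtain w where w: "w \<in> V" "1 - \<phi> \<le> w"
    by auto
  have "\<exists>v\<in>V. a < v \<and> v \<le> a + (1 - 2 * \<phi> + 2 * \<phi> ^ Suc k)"
    if "a \<in> V" "b \<in> V" "a < b" for a b
  proof (cases "a < 1 - \<phi> ^ Suc k")
    case True
    moreover have "0 \<le> a" using V \<open>a \<in> V\<close> \<phi> by auto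
    ultimately obtain p where p: "p \<in> cantor_left_endpoints \<phi> (Suc k)" "a < p"
        "p \<le> a + (1 - 2 * \<phi> + \<phi> ^ Suc k)"
      using ex_next_left_endpoint[OF \<phi>, of a "Suc k"] by blast
    obtain v where "v \<in> V" "p \<le> v" "v \<le> p + \<phi> ^ Suc k"
      using hit[OF p(1)] by auto
    then show ?thesis
      using p by (intro bexI[of _ v]) auto
  next
    case False
    moreover have "b \<le> 1" using V \<open>b \<in> V\<close> \<phi> by auto
    ultimately show ?thesis
      using that \<phi> pow by (intro bexI[of _ b]) auto
  qed
  moreover have "v \<le> \<phi> \<or> 1 - \<phi> \<le> v" if "v \<in> V" for v
    using V that by auto
  moreover have "0 < 1 - 2 * \<phi> + 2 * \<phi> ^ Suc k"
    using \<phi> pow by linarith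
  ultimately show ?thesis
    using connectivity_threshold_bounds[of V "1 - 2 * \<phi> + 2 * \<phi> ^ Suc k" \<phi> "1 - \<phi>" u w]
      \<open>finite V\<close> u w \<phi> by (simp add: algebra_simps)
qed

section \<open>The Cantor distribution\<close>

lemma cantor_series_bounds:
  fixes \<phi> :: real and z :: "nat \<Rightarrow> real"
  assumes "0 < \<phi>" "\<phi> < 1 / 2" and z: "\<And>i. z i \<in> {0, 1 - \<phi>}"
  shows "summable (\<lambda>i. \<phi> ^ i * z i)" and "(\<Sum>i. \<phi> ^ i * z i) \<in> {0..1}"
proof -
  have sums: "(\<lambda>i. \<phi> ^ i * (1 - \<phi>)) sums 1"
    using sums_mult2[OF geometric_sums[of \<phi>], of "1 - \<phi>"] assms(1,2) by simp
  have le: "0 \<le> \<phi> ^ i * z i" "\<phi> ^ i * z i \<le> \<phi> ^ i * (1 - \<phi>)" for i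
    using z[of i] assms(1,2) by (auto intro!: mult_left_mono)
  show summable: "summable (\<lambda>i. \<phi> ^ i * z i)"
    by (rule summable_comparison_test'[OF sums_summable[OF sums], of 0]) (use le in auto)
  have "(\<Sum>i. \<phi> ^ i * z i) \<le> (\<Sum>i. \<phi> ^ i * (1 - \<phi>))"
    by (rule suminf_le) (use le summable sums in \<open>auto simp: sums_iff\<close>)
  then show "(\<Sum>i. \<phi> ^ i * z i) \<in> {0..1}"
    using sums suminf_nonneg[OF summable] le by (auto simp: sums_iff)
qed

text \<open>The tail of the series is another such series scaled by \<open>\<phi> ^ k\<close>, hence lies in \<open>{0..\<phi> ^ k}\<close>.\<close>

lemma cantor_series_in_cylinder:
  fixes \<phi> :: real and z :: "nat \<Rightarrow> real"
  assumes "0 < \<phi>" "\<phi> < 1 / 2" and z: "\<And>i. z i \<in> {0, 1 - \<phi>}"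
  shows "(\<Sum>i. \<phi> ^ i * z i) \<in> {(\<Sum>i<k. \<phi> ^ i * z i)..(\<Sum>i<k. \<phi> ^ i * z i) + \<phi> ^ k}"
proof -
  note tail = cantor_series_bounds[OF assms(1,2), of "\<lambda>i. z (i + k)", OF z]
  have "(\<Sum>i. \<phi> ^ i * z i) = (\<Sum>i. \<phi> ^ (i + k) * z (i + k)) + (\<Sum>i<k. \<phi> ^ i * z i)"
    by (rule suminf_split_initial_segment[OF cantor_series_bounds(1)[OF assms]])
  also have "(\<Sum>i. \<phi> ^ (i + k) * z (i + k)) = \<phi> ^ k * (\<Sum>i. \<phi> ^ i * z (i + k))"
    using suminf_mult[OF tail(1), of "\<phi> ^ k"] by (simp add: power_add mult_ac)
  finally show ?thesis
    using tail(2) assms(1) mult_left_mono[of "\<Sum>i. \<phi> ^ i * z (i + k)" 1 "\<phi> ^ k"] by auto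
qed

abbreviation digit_space :: "real \<Rightarrow> (nat \<Rightarrow> real) measure" where
  "digit_space \<phi> \<equiv> \<Pi>\<^sub>M i\<in>(UNIV :: nat set). measure_pmf (pmf_of_set {0, 1 - \<phi>})"

lemma AE_digit_space: "AE z in digit_space \<phi>. \<forall>i. z i \<in> {0, 1 - \<phi>}"
proof -
  have "AE z in digit_space \<phi>. z i \<in> {0, 1 - \<phi>}" for i
    by (rule AE_PiM_component[where P = "\<lambda>x. x \<in> {0, 1 - \<phi>}"])
      (auto simp: AE_measure_pmf_iff measure_pmf.prob_space_axioms)
  then show ?thesis unfolding AE_all_countable by blast
qed

lemma AE_cantor_distribution_halves:
  assumes "0 < \<phi>" "\<phi> < 1 / 2"
  shows "AE x in cantor_distribution \<phi>. x \<in> {0..\<phi>} \<union> {1 - \<phi>..1}"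
  unfolding cantor_distribution_def
proof (subst AE_distr_iff[OF measurable_cantor_series])
  show "AE z in digit_space \<phi>. (\<Sum>i. \<phi> ^ i * z i) \<in> {0..\<phi>} \<union> {1 - \<phi>..1}"
    using AE_digit_space
  proof eventually_elim
    case (elim z)
    then show ?case
      using cantor_series_in_cylinder[OF assms, of z 1] cantor_series_bounds(2)[OF assms, of z]
      by (auto dest: spec[of _ 0])
  qed
qed simp

lemma measure_cylinder_pos:
  assumes "0 < \<phi>" "\<phi> < 1 / 2" "p \<in> cantor_left_endpoints \<phi> k"
  shows "measure (cantor_distribution \<phi>) {p..p + \<phi> ^ k} > 0"
proof -
  interpret product_prob_space "\<lambda>_. measure_pmf (pmf_of_set {0, 1 - \<phi>})" "UNIV :: nat set"
    by unfold_locales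
  obtain w where w: "\<And>i. w i \<in> {0, 1 - \<phi>}" "p = (\<Sum>i<k. \<phi> ^ i * w i)"
    using cantor_left_endpoint_digits[OF assms(3)] by blast
  define A where "A = prod_emb UNIV (\<lambda>_. measure_pmf (pmf_of_set {0, 1 - \<phi>})) {..<k}
    (\<Pi>\<^sub>E i\<in>{..<k}. {w i})"
  have "measure (digit_space \<phi>) A = (\<Prod>i<k. pmf (pmf_of_set {0, 1 - \<phi>}) (w i))"
    unfolding A_def by (subst measure_PiM_emb) (auto simp: measure_pmf_single)
  also have "\<dots> > 0"
    using w(1) by (intro prod_pos) (auto simp: card_gt_0_iff)
  also have "measure (digit_space \<phi>) A \<le>
      measure (digit_space \<phi>) ((\<lambda>z. \<Sum>i. \<phi> ^ i * z i) -` {p..p + \<phi> ^ k} \<inter> space (digit_space \<phi>))"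
  proof (rule finite_measure_mono_AE)
    show "AE z in digit_space \<phi>. z \<in> A \<longrightarrow>
        z \<in> (\<lambda>z. \<Sum>i. \<phi> ^ i * z i) -` {p..p + \<phi> ^ k} \<inter> space (digit_space \<phi>)"
      using AE_digit_space
    proof eventually_elim
      case (elim z)
      have "z i = w i" if "z \<in> A" "i < k" for i
        using that by (auto simp: A_def prod_emb_def PiE_iff)
      then have "z \<in> A \<Longrightarrow> (\<Sum>i<k. \<phi> ^ i * z i) = p"
        using w(2) by (auto intro!: sum.cong)
      then show ?case
        using cantor_series_in_cylinder[OF assms(1,2), of z k] elim
        by (auto simp: space_PiM)
    qed
    show "(\<lambda>z. \<Sum>i. \<phi> ^ i * z i) -` {p..p + \<phi> ^ k} \<inter> space (digit_space \<phi>)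
        \<in> sets (digit_space \<phi>)"
      by (rule measurable_sets[OF measurable_cantor_series]) simp
  qed
  finally show ?thesis
    unfolding cantor_distribution_def
    by (subst measure_distr[OF measurable_cantor_series]) auto
qed

section \<open>Hitting times of an independent sample\<close>

text \<open>
  With \<open>q\<close> the probability of \<open>A\<close>, the first \<open>n\<close> trials all miss \<open>A\<close> with probability
  \<open>(1 - q) ^ n\<close>, which tends to zero.
\<close>

lemma (in prob_space) indep_vars_AE_hit:
  assumes indep: "indep_vars (\<lambda>_. N) X {1::nat..}"
    and distr: "\<And>i. i \<ge> 1 \<Longrightarrow> distr M N (X i) = D"
    and A: "A \<in> sets N" "measure D A > 0"
  shows "AE \<omega> in M. \<exists>i\<ge>1. X i \<omega> \<in> A"
proof -
  have X: "X i \<in> measurable M N" if "i \<ge> 1" for i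
    using indep that by (auto simp: indep_vars_def)
  have N: "prob_space D" "space D = space N" "sets D = sets N"
    using distr[of 1] X[of 1] prob_space_distr[of "X 1" N] by auto
  interpret D: prob_space D by fact
  define q where "q = measure D A"
  have q: "0 < q" "q \<le> 1"
    using A(2) by (auto simp: q_def)
  define B where "B = {\<omega> \<in> space M. \<forall>i\<ge>1. X i \<omega> \<notin> A}"
  have miss: "X i -` (space N - A) \<inter> space M = {\<omega> \<in> space M. X i \<omega> \<notin> A}" if "i \<ge> 1" for i
    using measurable_space[OF X[OF that]] by auto
  have miss_sets: "{\<omega> \<in> space M. X i \<omega> \<notin> A} \<in> events" if "i \<ge> 1" for i
    using measurable_sets[OF X[OF that], of "space N - A"] A(1) miss[OF that] by auto
  have B_sets: "B \<in> events"
  proof -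
    have "B = (\<Inter>i\<in>{1..}. {\<omega> \<in> space M. X i \<omega> \<notin> A})"
      by (auto simp: B_def)
    also have "\<dots> \<in> events"
      using miss_sets by (intro sets.countable_INT') auto
    finally show ?thesis .
  qed
  have prob_miss: "prob {\<omega> \<in> space M. X i \<omega> \<notin> A} = 1 - q" if "i \<ge> 1" for i
  proof -
    have "prob {\<omega> \<in> space M. X i \<omega> \<notin> A} = measure (distr M N (X i)) (space N - A)"
      using A(1) by (subst measure_distr[OF X[OF that]]) (auto simp: miss[OF that])
    also have "\<dots> = 1 - q"
      using distr[OF that] N A(1) D.prob_compl[of A] by (simp add: q_def)
    finally show ?thesis .
  qed
  have bound: "prob B \<le> (1 - q) ^ n" if "n \<ge> 1" for n
  proof -
    have "prob B \<le> prob (\<Inter>i\<in>{1..n}. X i -` (space N - A) \<inter> space M)"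
    proof (rule finite_measure_mono)
      show "B \<subseteq> (\<Inter>i\<in>{1..n}. X i -` (space N - A) \<inter> space M)"
        using miss by (auto simp: B_def)
      show "(\<Inter>i\<in>{1..n}. X i -` (space N - A) \<inter> space M) \<in> events"
        using that A(1) by (intro sets.finite_INT) (auto intro!: measurable_sets[OF X])
    qed
    also have "\<dots> = (\<Prod>i\<in>{1..n}. prob (X i -` (space N - A) \<inter> space M))"
      by (rule indep_varsD[OF indep]) (use that A(1) in auto)
    also have "\<dots> = (1 - q) ^ n"
      by (simp add: miss prob_miss)
    finally show ?thesis .
  qed
  have "(\<lambda>n. (1 - q) ^ n) \<longlonglongrightarrow> 0"
    using q by (intro LIMSEQ_realpow_zero) auto
  then have "prob B \<le> 0"
    by (rule LIMSEQ_le_const) (use bound in blast)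
  then have "B \<in> null_sets M"
    using B_sets by (simp add: null_sets_def emeasure_eq_measure antisym)
  then show ?thesis
    by (rule AE_I') (auto simp: B_def)
qed

section \<open>Convergence of the connectivity threshold\<close>

theorem theorem1:
  fixes M :: "'a measure" and X :: "nat \<Rightarrow> 'a \<Rightarrow> real" and \<phi> :: real
  assumes "0 < \<phi>" and "\<phi> < 1 / 2"
    and "prob_space M"
    and "prob_space.indep_vars M (\<lambda>_. borel) X {1..}"
    and "\<And>i. i \<ge> 1 \<Longrightarrow> distr M borel (X i) = cantor_distribution \<phi>"
  shows "AE \<omega> in M.
           (\<lambda>n. connectivity_threshold ((\<lambda>i. X i \<omega>) ` {1..n})) \<longlonglongrightarrow> 1 - 2 * \<phi>"
proof -
  interpret prob_space M by fact
  have X: "X i \<in> borel_measurable M" if "i \<ge> 1" for i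
    using assms(4) that by (auto simp: indep_vars_def)
  have "AE \<omega> in M. i \<ge> 1 \<longrightarrow> X i \<omega> \<in> {0..\<phi>} \<union> {1 - \<phi>..1}" for i
  proof (cases "i \<ge> 1")
    case True
    have "AE x in distr M borel (X i). x \<in> {0..\<phi>} \<union> {1 - \<phi>..1}"
      unfolding assms(5)[OF True] by (rule AE_cantor_distribution_halves[OF assms(1,2)])
    then show ?thesis
      using AE_distrD[OF X[OF True]] by auto
  qed simp
  then have "AE \<omega> in M. \<forall>i. i \<ge> 1 \<longrightarrow> X i \<omega> \<in> {0..\<phi>} \<union> {1 - \<phi>..1}"
    unfolding AE_all_countable by blast
  moreover have "AE \<omega> in M. \<forall>k. \<forall>p\<in>cantor_left_endpoints \<phi> k. \<exists>i\<ge>1. X i \<omega> \<in> {p..p + \<phi> ^ k}"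
    unfolding AE_all_countable
    by (intro allI AE_finite_allI finite_cantor_left_endpoints
        indep_vars_AE_hit[OF assms(4,5)] measure_cylinder_pos[OF assms(1,2)]) auto
  ultimately show ?thesis
  proof eventually_elim
    case (elim \<omega>)
    let ?V = "\<lambda>n. (\<lambda>i. X i \<omega>) ` {1..n}"
    have eventually_bounds: "eventually (\<lambda>n. connectivity_threshold (?V n) \<in>
        {1 - 2 * \<phi>..1 - 2 * \<phi> + 2 * \<phi> ^ Suc k}) sequentially" for k
    proof -
      have "eventually (\<lambda>n. \<forall>p\<in>cantor_left_endpoints \<phi> (Suc k).
          ?V n \<inter> {p..p + \<phi> ^ Suc k} \<noteq> {}) sequentially"
      proof (intro eventually_ball_finite finite_cantor_left_endpoints ballI)
        fix p assume "p \<in> cantor_left_endpoints \<phi> (Suc k)"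
        then obtain i where "i \<ge> 1" "X i \<omega> \<in> {p..p + \<phi> ^ Suc k}"
          using elim(2) by blast
        then show "eventually (\<lambda>n. ?V n \<inter> {p..p + \<phi> ^ Suc k} \<noteq> {}) sequentially"
          by (intro eventually_sequentiallyI[of i]) (fastforce simp del: power_Suc)
      qed
      then show ?thesis
      proof eventually_elim
        case (elim n)
        show ?case
          by (rule connectivity_threshold_if_hits_cylinders[OF assms(1,2)])
            (use elim \<open>\<forall>i. i \<ge> 1 \<longrightarrow> X i \<omega> \<in> {0..\<phi>} \<union> {1 - \<phi>..1}\<close> in auto)
      qed
    qed
    show ?case
    proof (rule tendstoI)
      fix e :: real assume "0 < e"
      have "(\<lambda>k. 2 * \<phi> ^ Suc k) \<longlonglongrightarrow> 2 * 0"
        using assms(1,2) by (intro tendsto_mult_left LIMSEQ_Suc LIMSEQ_realpow_zero) auto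
      then have "eventually (\<lambda>k. 2 * \<phi> ^ Suc k < e) sequentially"
        by (rule order_tendstoD(2)) (use \<open>0 < e\<close> in simp)
      then obtain k where "2 * \<phi> ^ Suc k < e"
        by (meson eventually_sequentially order_refl)
      with eventually_bounds[of k]
      show "eventually (\<lambda>n. dist (connectivity_threshold (?V n)) (1 - 2 * \<phi>) < e) sequentially"
        by (auto elim!: eventually_mono simp: dist_real_def)
    qed
  qed
qed

end
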